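(* Consider the MGU network composed of $L$ stacked MGU layers, with initial hidden states $\boldsymbol h_0^{(l)}\in[-1,1]^{n_h^{(l)}}$ for every $l\in\{1,\dots,L\}$ and inputs $\boldsymbol u_k\in\mathcal U=[-1,1]^{n_u}$ for all $k\in\mathbb N$. For each $l$ let $$\bar\sigma_f^{(l)}:=\sigma\left(\left\|\begin{bmatrix}W_f^{(l)} & R_f^{(l)} & \boldsymbol b_f^{(l)}\end{bmatrix}\right\|\right),\qquad \bar\phi_{\tilde h}^{(l)}:=\phi\left(\left\|\begin{bmatrix}W_{\tilde h}^{(l)} & R_{\tilde h}^{(l)} & \boldsymbol b_{\tilde h}^{(l)}\end{bmatrix}\right\|\right).$$ If the sufficient condition for $\delta$ISS of the network holds, i.e. $$\bar\sigma_f^{(l)}+\big(\bar\sigma_f^{(l)}\big)^2\|R_{\tilde h}^{(l)}\|+\tfrac14\|R_f^{(l)}\|\left(\bar\sigma_f^{(l)}\|R_{\tilde h}^{(l)}\|+\bar\phi_{\tilde h}^{(l)}+1\right)<1\quad\text{for every } l\in\{1,\dots,L\},$$ then the MGU network is also ISS in $\mathcal H_{\mathrm{inv}}=\prod_{l=1}^L[-1,1]^{n_h^{(l)}}$ with respect to $\mathcal U$.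
   Context: Notation: $\mathbb N$ includes $0$; $\|\cdot\|$ is the infinity norm of vectors and the induced infinity norm of matrices (maximum absolute row sum); $\circ$ is the element-wise product; $\sigma(x)=1/(1+e^{-x})$ and $\phi(x)=\tanh(x)$; bold $\boldsymbol\sigma,\boldsymbol\phi$ denote component-wise application; $\boldsymbol 1_n$ is the all-ones vector; $[A\ B\ C]$ is horizontal concatenation. MGU network: layer $l\in\{1,\dots,L\}$ has hidden state $\boldsymbol h_k^{(l)}\in\mathbb R^{n_h^{(l)}}$ and input $\tilde{\boldsymbol u}_k^{(l)}\in\mathbb R^{n_{\tilde u}^{(l)}}$, where $\tilde{\boldsymbol u}_k^{(1)}=\boldsymbol u_k\in\mathbb R^{n_u}$ and $\tilde{\boldsymbol u}_k^{(l)}=\boldsymbol h_{k+1}^{(l-1)}$ for $l\ge2$ (so $n_{\tilde u}^{(1)}=n_u$, $n_{\tilde u}^{(l)}=n_h^{(l-1)}$ for $l\ge 2$), and $$\boldsymbol f_k^{(l)}=\boldsymbol\sigma(W_f^{(l)}\tilde{\boldsymbol u}_k^{(l)}+R_f^{(l)}\boldsymbol h_k^{(l)}+\boldsymbol b_f^{(l)}),$$ $$\tilde{\boldsymbol h}_k^{(l)}=\boldsymbol\phi(W_{\tilde h}^{(l)}\tilde{\boldsymbol u}_k^{(l)}+R_{\tilde h}^{(l)}(\boldsymbol f_k^{(l)}\circ\boldsymbol h_k^{(l)})+\boldsymbol b_{\tilde h}^{(l)}),$$ $$\boldsymbol h_{k+1}^{(l)}=(\boldsymbol 1_{n_h^{(l)}}-\boldsymbol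 f_k^{(l)})\circ\boldsymbol h_k^{(l)}+\boldsymbol f_k^{(l)}\circ\tilde{\boldsymbol h}_k^{(l)},$$ where $W_f^{(l)},W_{\tilde h}^{(l)}\in\mathbb R^{n_h^{(l)}\times n_{\tilde u}^{(l)}}$, $R_f^{(l)},R_{\tilde h}^{(l)}\in\mathbb R^{n_h^{(l)}\times n_h^{(l)}}$, $\boldsymbol b_f^{(l)},\boldsymbol b_{\tilde h}^{(l)}\in\mathbb R^{n_h^{(l)}}$. The output is $\boldsymbol y_k=W_y\boldsymbol h_{k+1}^{(L)}+\boldsymbol b_y$ (irrelevant for state stability). The network state is $\boldsymbol h_k=[\boldsymbol h_k^{(1)\top},\dots,\boldsymbol h_k^{(L)\top}]^\top\in\mathbb R^{n_h}$, $n_h=\sum_l n_h^{(l)}$, which evolves as a system with input $\boldsymbol u_k$. Comparison functions: $\gamma:\mathbb R_{\ge0}\to\mathbb R_{\ge0}$ is class $\mathcal K$ if continuous, strictly increasing, $\gamma(0)=0$; class $\mathcal K_\infty$ if moreover $\gamma(r)\to\infty$ as $r\to\infty$. A continuous $\psi:\mathbb R_{\ge0}\times\mathbb N\to\mathbb R_{\ge0}$ is class $\mathcal{KL}$ if $\psi(\cdot,k)\in\mathcal K$ for each fixed $k$ and, for each fixed $r>0$, $\psi(r,k)$ is strictly decreasing to zero as $k\to\infty$. ISS (with bias term): a system $\boldsymbol x_{k+1}=\boldsymbol w(\boldsymbol x_k,\boldsymbol u_k)$ is ISS in a compact forward invariant set $\mathcal X$ with respect to a compact set $\mathcal U$ if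 there exist $\psi\in\mathcal{KL}$ and $\gamma_u,\gamma_b\in\mathcal K_\infty$ such that for any $k\in\mathbb N$, any $\boldsymbol x_0\in\mathcal X$, any inputs $\boldsymbol u_0,\dots,\boldsymbol u_{k-1}\in\mathcal U$, and any bias vector $\boldsymbol b$, $$\|\boldsymbol x_k\|\le\psi(\|\boldsymbol x_0\|,k)+\gamma_u\Big(\max_{0\le z<k}\|\boldsymbol u_z\|\Big)+\gamma_b(\|\boldsymbol b\|),$$ with the maximum over an empty set taken to be $0$. For the MGU network, $\boldsymbol x_k=\boldsymbol h_k$ and the bias vector is $\boldsymbol b=[\boldsymbol b_{\tilde h}^{(1)\top},\dots,\boldsymbol b_{\tilde h}^{(L)\top}]^\top\in\mathbb R^{n_h}$: the functions $\psi,\gamma_u,\gamma_b$ may depend on all $W_f^{(l)},W_{\tilde h}^{(l)},R_f^{(l)},R_{\tilde h}^{(l)},\boldsymbol b_f^{(l)}$, and the bound holds for every value of $\boldsymbol b$ (the biases in the dynamics being replaced by that value). *)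

theory Defs
  imports "Jordan_Normal_Form.Matrix" "HOL-Analysis.Function_Topology"
begin

definition vec_norm :: "real vec \<Rightarrow> real" where
  "vec_norm v = Max (insert 0 ((\<lambda>i. \<bar>v $ i\<bar>) ` {..<dim_vec v}))"

definition mat_norm :: "real mat \<Rightarrow> real" where
  "mat_norm A = Max (insert 0 ((\<lambda>i. \<Sum>j<dim_col A. \<bar>A $$ (i, j)\<bar>) ` {..<dim_row A}))"

definition hadamard :: "real vec \<Rightarrow> real vec \<Rightarrow> real vec" (infixl \<open>\<circ>\<^sub>h\<close> 72) where
  "v \<circ>\<^sub>h w = vec (dim_vec v) (\<lambda>i. v $ i * w $ i)"

definition ones :: "nat \<Rightarrow> real vec" where
  "ones n = vec n (\<lambda>_. 1)"

definition sigmoid :: "real \<Rightarrow> real" where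
  "sigmoid x = 1 / (1 + exp (- x))"

definition unit_cube :: "nat \<Rightarrow> real vec set" where
  "unit_cube n = {v \<in> carrier_vec n. \<forall>i<n. v $ i \<in> {-1..1}}"

definition hconcat3 :: "real mat \<Rightarrow> real mat \<Rightarrow> real vec \<Rightarrow> real mat" where
  "hconcat3 A B v = mat_of_cols (dim_row A) (cols A @ cols B @ [v])"


section \<open>Comparison functions\<close>

text \<open>Comparison functions are functions on all of \<open>real\<close> of which only the restriction to the
  nonnegative reals is used.\<close>

definition class_K :: "(real \<Rightarrow> real) set" where
  "class_K = {\<gamma>. \<gamma> \<in> {0..} \<rightarrow> {0..} \<and> continuous_on {0..} \<gamma> \<and> strict_mono_on {0..} \<gamma> \<and> \<gamma> 0 = 0}"

definition class_K_inf :: "(real \<Rightarrow> real) set" where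
  "class_K_inf = {\<gamma> \<in> class_K. filterlim \<gamma> at_top at_top}"

definition class_KL :: "(real \<Rightarrow> nat \<Rightarrow> real) set" where
  "class_KL = {\<psi>. continuous_on ({0..} \<times> UNIV) (\<lambda>(r, k). \<psi> r k) \<and>
                 (\<forall>k. (\<lambda>r. \<psi> r k) \<in> class_K) \<and>
                 (\<forall>r>0. (\<forall>j k. j < k \<longrightarrow> \<psi> r k < \<psi> r j) \<and> \<psi> r \<longlonglongrightarrow> 0)}"


section \<open>Input-to-state stability with a bias term\<close>

text \<open>The type \<^typ>\<open>real vec\<close> contains vectors of every dimension and carries no topology.
  Subsets of \<open>\<real>\<^sup>n\<close> are identified with sets of functions on \<open>{..<n}\<close>, with the product topology.\<close>

definition compact_vecs :: "nat \<Rightarrow> real vec set \<Rightarrow> bool" where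
  "compact_vecs n X \<longleftrightarrow> X \<subseteq> carrier_vec n \<and>
     compactin (product_topology (\<lambda>_. euclideanreal) {..<n}) ((\<lambda>v. restrict (($) v) {..<n}) ` X)"

primrec trajectory :: "('s \<Rightarrow> 'i \<Rightarrow> 's) \<Rightarrow> 's \<Rightarrow> (nat \<Rightarrow> 'i) \<Rightarrow> nat \<Rightarrow> 's" where
  "trajectory w x u 0 = x"
| "trajectory w x u (Suc k) = w (trajectory w x u k) (u k)"

definition forward_invariant :: "('s \<Rightarrow> 'i \<Rightarrow> 's) \<Rightarrow> 's set \<Rightarrow> 'i set \<Rightarrow> bool" where
  "forward_invariant w X U \<longleftrightarrow> (\<forall>x\<in>X. \<forall>u\<in>U. w x u \<in> X)"

definition max_input :: "(nat \<Rightarrow> real vec) \<Rightarrow> nat \<Rightarrow> real" where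
  "max_input u k = (if k = 0 then 0 else Max ((\<lambda>z. vec_norm (u z)) ` {..<k}))"

text \<open>\<open>w b\<close> is the state update under the bias vector \<open>b \<in> \<real>\<^sup>p\<close>; states lie in \<open>\<real>\<^sup>n\<close>, inputs in
  \<open>\<real>\<^sup>m\<close>. The comparison functions are uniform in \<open>b\<close>.\<close>

definition ISS :: "nat \<Rightarrow> nat \<Rightarrow> nat \<Rightarrow> (real vec \<Rightarrow> real vec \<Rightarrow> real vec \<Rightarrow> real vec) \<Rightarrow>
    real vec set \<Rightarrow> real vec set \<Rightarrow> bool" where
  "ISS n m p w X U \<longleftrightarrow>
     compact_vecs n X \<and> compact_vecs m U \<and>
     (\<forall>b \<in> carrier_vec p. forward_invariant (w b) X U) \<and>
     (\<exists>\<psi> \<in> class_KL. \<exists>\<gamma>\<^sub>u \<in> class_K_inf. \<exists>\<gamma>\<^sub>b \<in> class_K_inf.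
        \<forall>k. \<forall>x\<^sub>0 \<in> X. \<forall>u. (\<forall>z<k. u z \<in> U) \<longrightarrow> (\<forall>b \<in> carrier_vec p.
          vec_norm (trajectory (w b) x\<^sub>0 u k)
            \<le> \<psi> (vec_norm x\<^sub>0) k + \<gamma>\<^sub>u (max_input u k) + \<gamma>\<^sub>b (vec_norm b)))"


section \<open>Stacked minimal gated unit networks\<close>

text \<open>Layers are numbered \<open>1, \<dots>, num_layers\<close>; values of the fields outside this range are irrelevant.
  The affine readout of the last layer does not enter the state dynamics and is omitted.\<close>

record mgu =
  num_layers :: nat
  dim_u :: nat
  dim_h :: "nat \<Rightarrow> nat"
  W_f :: "nat \<Rightarrow> real mat"
  R_f :: "nat \<Rightarrow> real mat"
  b_f :: "nat \<Rightarrow> real vec"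
  W_h :: "nat \<Rightarrow> real mat"
  R_h :: "nat \<Rightarrow> real mat"
  b_h :: "nat \<Rightarrow> real vec"

definition dim_in :: "mgu \<Rightarrow> nat \<Rightarrow> nat" where
  "dim_in N l = (if l = 1 then dim_u N else dim_h N (l - 1))"

definition mgu_network :: "mgu \<Rightarrow> bool" where
  "mgu_network N \<longleftrightarrow> 1 \<le> num_layers N \<and> (\<forall>l \<in> {1..num_layers N}.
     W_f N l \<in> carrier_mat (dim_h N l) (dim_in N l) \<and>
     R_f N l \<in> carrier_mat (dim_h N l) (dim_h N l) \<and>
     b_f N l \<in> carrier_vec (dim_h N l) \<and>
     W_h N l \<in> carrier_mat (dim_h N l) (dim_in N l) \<and>
     R_h N l \<in> carrier_mat (dim_h N l) (dim_h N l) \<and>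
     b_h N l \<in> carrier_vec (dim_h N l))"

definition forget_gate :: "mgu \<Rightarrow> nat \<Rightarrow> real vec \<Rightarrow> real vec \<Rightarrow> real vec" where
  "forget_gate N l u h = map_vec sigmoid (W_f N l *\<^sub>v u + R_f N l *\<^sub>v h + b_f N l)"

definition candidate_state :: "mgu \<Rightarrow> nat \<Rightarrow> real vec \<Rightarrow> real vec \<Rightarrow> real vec" where
  "candidate_state N l u h =
     map_vec tanh (W_h N l *\<^sub>v u + R_h N l *\<^sub>v (forget_gate N l u h \<circ>\<^sub>h h) + b_h N l)"

definition layer_update :: "mgu \<Rightarrow> nat \<Rightarrow> real vec \<Rightarrow> real vec \<Rightarrow> real vec" where
  "layer_update N l u h =
     (ones (dim_h N l) - forget_gate N l u h) \<circ>\<^sub>h h + forget_gate N l u h \<circ>\<^sub>h candidate_state N l u h"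

definition dim_upto :: "mgu \<Rightarrow> nat \<Rightarrow> nat" where
  "dim_upto N l = (\<Sum>i\<in>{1..l}. dim_h N i)"

definition dim_state :: "mgu \<Rightarrow> nat" where
  "dim_state N = dim_upto N (num_layers N)"

text \<open>\<open>block N l x\<close> is the layer-\<open>l\<close> part of a vector stacked over all layers.\<close>

definition block :: "mgu \<Rightarrow> nat \<Rightarrow> real vec \<Rightarrow> real vec" where
  "block N l x = vec (dim_h N l) (\<lambda>i. x $ (dim_upto N (l - 1) + i))"

primrec stack :: "(nat \<Rightarrow> real vec) \<Rightarrow> nat \<Rightarrow> real vec" where
  "stack g 0 = vNil"
| "stack g (Suc l) = stack g l @\<^sub>v g (Suc l)"

text \<open>\<open>next_hidden N h u l\<close> is the state of layer \<open>l\<close> at time \<open>k + 1\<close> when \<open>h\<close> is the network state and \<open>u\<close> the input at time \<open>k\<close>,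
  with the convention that layer \<open>0\<close> is the input itself: layer \<open>l\<close> reads the already updated
  state of layer \<open>l - 1\<close>.\<close>

primrec next_hidden :: "mgu \<Rightarrow> real vec \<Rightarrow> real vec \<Rightarrow> nat \<Rightarrow> real vec" where
  "next_hidden N h u 0 = u"
| "next_hidden N h u (Suc l) = layer_update N (Suc l) (next_hidden N h u l) (block N (Suc l) h)"

definition mgu_map :: "mgu \<Rightarrow> real vec \<Rightarrow> real vec \<Rightarrow> real vec" where
  "mgu_map N h u = stack (next_hidden N h u) (num_layers N)"

text \<open>The network in which the candidate biases \<open>b_h\<close> are replaced by the blocks of \<open>b\<close>.\<close>

definition with_bias :: "mgu \<Rightarrow> real vec \<Rightarrow> mgu" where
  "with_bias N b = N\<lparr>b_h := (\<lambda>l. block N l b)\<rparr>"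

definition mgu_ISS :: "mgu \<Rightarrow> real vec set \<Rightarrow> real vec set \<Rightarrow> bool" where
  "mgu_ISS N X U \<longleftrightarrow>
     ISS (dim_state N) (dim_u N) (dim_state N) (\<lambda>b. mgu_map (with_bias N b)) X U"

definition H_inv :: "mgu \<Rightarrow> real vec set" where
  "H_inv N = {h \<in> carrier_vec (dim_state N).
     \<forall>l \<in> {1..num_layers N}. block N l h \<in> unit_cube (dim_h N l)}"

definition sigma_f_bar :: "mgu \<Rightarrow> nat \<Rightarrow> real" where
  "sigma_f_bar N l = sigmoid (mat_norm (hconcat3 (W_f N l) (R_f N l) (b_f N l)))"

definition phi_h_bar :: "mgu \<Rightarrow> nat \<Rightarrow> real" where
  "phi_h_bar N l = tanh (mat_norm (hconcat3 (W_h N l) (R_h N l) (b_h N l)))"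


section \<open>Stacking and its inverse\<close>

lemma stack_carrier:
  assumes "\<forall>l \<in> {1..L}. g l \<in> carrier_vec (dim_h N l)"
  shows "stack g L \<in> carrier_vec (dim_upto N L)"
  using assms
proof (induction L)
  case 0
  show ?case by (simp add: dim_upto_def)
next
  case (Suc L)
  have "stack g L \<in> carrier_vec (dim_upto N L)"
    by (rule Suc.IH) (use Suc.prems in fastforce)
  moreover have "g (Suc L) \<in> carrier_vec (dim_h N (Suc L))"
    by (rule bspec[OF Suc.prems]) simp
  moreover have "dim_upto N (Suc L) = dim_upto N L + dim_h N (Suc L)"
    by (simp add: dim_upto_def)
  ultimately show ?case by (simp only: stack.simps append_carrier_vec)
qed

lemma block_stack:
  assumes "\<forall>l \<in> {1..L}. g l \<in> carrier_vec (dim_h N l)" and "l \<in> {1..L}"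
  shows "block N l (stack g L) = g l"
  using assms
proof (induction L)
  case 0
  then show ?case by simp
next
  case (Suc L)
  have pr: "\<forall>l \<in> {1..L}. g l \<in> carrier_vec (dim_h N l)"
    using Suc.prems(1) by fastforce
  have gl: "dim_vec (g l) = dim_h N l"
    using bspec[OF Suc.prems(1) Suc.prems(2)] by (rule carrier_vecD)
  have st: "dim_vec (stack g L) = dim_upto N L"
    using stack_carrier[OF pr] by (rule carrier_vecD)
  show ?case
  proof (cases "l = Suc L")
    case True
    show ?thesis
    proof (rule eq_vecI)
      fix i assume i: "i < dim_vec (g l)"
      have "block N l (stack g (Suc L)) $ i = (stack g L @\<^sub>v g l) $ (dim_upto N L + i)"
        using i gl True by (simp only: block_def index_vec stack.simps diff_Suc_1)
      also have "\<dots> = g l $ i"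
        using i st by (subst index_append_vec(1)) simp_all
      finally show "block N l (stack g (Suc L)) $ i = g l $ i" .
    qed (simp only: block_def dim_vec gl)
  next
    case False
    then have l: "1 \<le> l" "l \<le> L" using Suc.prems(2) by auto
    have le: "dim_upto N (l - 1) + dim_h N l \<le> dim_upto N L"
    proof -
      have "dim_upto N (l - 1) + dim_h N l = dim_upto N l"
        using l(1) by (cases l) (simp_all add: dim_upto_def)
      also have "\<dots> \<le> dim_upto N L"
        unfolding dim_upto_def by (rule sum_mono2) (use l in auto)
      finally show ?thesis .
    qed
    have "block N l (stack g (Suc L)) = block N l (stack g L)"
    proof (rule eq_vecI)
      fix i assume "i < dim_vec (block N l (stack g L))"
      then have i: "i < dim_h N l" by (simp only: block_def dim_vec)
      have "(stack g L @\<^sub>v g (Suc L)) $ (dim_upto N (l - 1) + i) = stack g L $ (dim_upto N (l - 1) + i)"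
        using i le st by (subst index_append_vec(1)) simp_all
      then show "block N l (stack g (Suc L)) $ i = block N l (stack g L) $ i"
        using i by (simp only: block_def index_vec stack.simps)
    qed (simp only: block_def dim_vec)
    also have "\<dots> = g l"
      by (rule Suc.IH[OF pr]) (use l in simp)
    finally show ?thesis .
  qed
qed

end

theory Submission
  imports Defs
begin

text \<open>
  The bound is linear in all three arguments: the state norm decays geometrically, and inputs and
  candidate biases enter through constant gains.

  For one layer write \<open>s\<close> for \<open>sigma_f_bar\<close> and \<open>r\<close> for the norm of \<open>R_h\<close>. On the unit cube the
  pre-activation of the forget gate is bounded by the norm of the concatenated matrix, so every gate
  value \<open>f\<close> lies in \<open>[1 - s, s]\<close>. Since \<open>\<bar>tanh x\<bar> \<le> \<bar>x\<bar>\<close>, the candidate state is at most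
  \<open>s r \<parallel>h\<parallel>\<close> plus terms linear in the input and in the bias. The new state is the convex combination
  of old and candidate state with weight \<open>f\<close>, which multiplies \<open>\<parallel>h\<parallel>\<close> by at most
  \<open>1 - f (1 - s r) \<le> 1 - (1 - s) (1 - s r)\<close> (\<open>layer_update_le\<close>). Because \<open>s \<ge> 1/2\<close>, the
  hypothesis \<open>s + s\<^sup>2 r + \<dots> < 1\<close> forces \<open>s r < (1 - s) / s \<le> 1\<close>, so this factor is below \<open>1\<close>
  (\<open>delta_ISS_condition_imp_rate\<close>). None of these constants involves the candidate bias, which makes
  the estimate uniform in it.

  The layers form a cascade in which layer \<open>l\<close> is driven by the already updated layer \<open>l - 1\<close>.
  Weighting the norm of layer \<open>l\<close> by \<open>e\<^sup>l\<close> with a small \<open>e\<close> yields a Lyapunov function in which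
  these couplings are dominated by the contraction of each layer (\<open>cascade_bound\<close>).

  Finally, the invariant set is the unit cube of the stacked state space
  (\<open>H_inv_eq_unit_cube\<close>), so it is compact, and convexity of the layer update together with
  \<open>\<bar>tanh x\<bar> \<le> 1\<close> makes it forward invariant for every bias (\<open>mgu_map_H_inv\<close>).
\<close>

section \<open>Infinity norms\<close>

lemma vec_norm_nonneg [simp]: "0 \<le> vec_norm v"
  unfolding vec_norm_def by (rule Max_ge) auto

lemma mat_norm_nonneg [simp]: "0 \<le> mat_norm A"
  unfolding mat_norm_def by (rule Max_ge) auto

lemma abs_index_le_vec_norm:
  assumes "i < dim_vec v"
  shows "\<bar>v $ i\<bar> \<le> vec_norm v"
  unfolding vec_norm_def by (rule Max_ge) (use assms in auto)

lemma vec_norm_leI: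
  assumes "0 \<le> c" and "\<And>i. i < dim_vec v \<Longrightarrow> \<bar>v $ i\<bar> \<le> c"
  shows "vec_norm v \<le> c"
  unfolding vec_norm_def using assms by (subst Max_le_iff) auto

lemma row_sum_le_mat_norm:
  assumes "i < dim_row A"
  shows "(\<Sum>j<dim_col A. \<bar>A $$ (i, j)\<bar>) \<le> mat_norm A"
  unfolding mat_norm_def by (rule Max_ge) (use assms in auto)

lemma unit_cube_iff: "v \<in> unit_cube n \<longleftrightarrow> v \<in> carrier_vec n \<and> vec_norm v \<le> 1"
proof
  assume v: "v \<in> unit_cube n"
  then have "vec_norm v \<le> 1"
    by (intro vec_norm_leI) (auto simp: unit_cube_def abs_le_iff minus_le_iff)
  with v show "v \<in> carrier_vec n \<and> vec_norm v \<le> 1" by (auto simp: unit_cube_def)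
next
  assume v: "v \<in> carrier_vec n \<and> vec_norm v \<le> 1"
  have "\<bar>v $ i\<bar> \<le> 1" if "i < n" for i
    using abs_index_le_vec_norm[of i v] v that by auto
  with v show "v \<in> unit_cube n" by (auto simp: unit_cube_def abs_le_iff minus_le_iff)
qed

lemma abs_mult_mat_vec_le_row_sum:
  assumes "A \<in> carrier_mat n m" "x \<in> carrier_vec m" "i < n"
  shows "\<bar>(A *\<^sub>v x) $ i\<bar> \<le> (\<Sum>j<dim_col A. \<bar>A $$ (i, j)\<bar>) * vec_norm x"
proof -
  have "(A *\<^sub>v x) $ i = (\<Sum>j<m. A $$ (i, j) * x $ j)"
    using assms by (auto simp: scalar_prod_def atLeast0LessThan)
  also have "\<bar>\<dots>\<bar> \<le> (\<Sum>j<m. \<bar>A $$ (i, j)\<bar> * \<bar>x $ j\<bar>)"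
    by (rule order_trans[OF sum_abs]) (simp add: abs_mult)
  also have "\<dots> \<le> (\<Sum>j<m. \<bar>A $$ (i, j)\<bar> * vec_norm x)"
    using assms by (intro sum_mono mult_left_mono abs_index_le_vec_norm) auto
  finally show ?thesis using assms by (simp add: sum_distrib_right)
qed

lemma abs_mult_mat_vec_le:
  assumes "A \<in> carrier_mat n m" "x \<in> carrier_vec m" "i < n"
  shows "\<bar>(A *\<^sub>v x) $ i\<bar> \<le> mat_norm A * vec_norm x"
proof -
  have "(\<Sum>j<dim_col A. \<bar>A $$ (i, j)\<bar>) \<le> mat_norm A"
    using assms by (intro row_sum_le_mat_norm) auto
  from order_trans[OF abs_mult_mat_vec_le_row_sum[OF assms] mult_right_mono[OF this]]
  show ?thesis by simp
qed

lemma row_sum_mat_of_cols: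
  assumes "i < n"
  shows "(\<Sum>j<dim_col (mat_of_cols n cs). \<bar>mat_of_cols n cs $$ (i, j)\<bar>) = (\<Sum>c\<leftarrow>cs. \<bar>c $ i\<bar>)"
  using assms by (simp add: sum_list_sum_nth atLeast0LessThan mat_of_cols_def)

lemma sum_list_cols:
  assumes "i < dim_row A"
  shows "(\<Sum>c\<leftarrow>cols A. \<bar>c $ i\<bar>) = (\<Sum>j<dim_col A. \<bar>A $$ (i, j)\<bar>)"
  using assms by (simp add: sum_list_sum_nth atLeast0LessThan)

text \<open>The bias is a column of the concatenated matrix, multiplied by the constant input \<open>1\<close>; hence
  the affine map is a matrix-vector product with a vector in the unit cube.\<close>

lemma abs_affine_le_mat_norm_hconcat3:
  assumes A: "A \<in> carrier_mat n m" and B: "B \<in> carrier_mat n k" and v: "v \<in> carrier_vec n"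
    and x: "x \<in> unit_cube m" and y: "y \<in> unit_cube k" and i: "i < n"
  shows "\<bar>(A *\<^sub>v x + B *\<^sub>v y + v) $ i\<bar> \<le> mat_norm (hconcat3 A B v)"
proof -
  let ?a = "\<Sum>j<dim_col A. \<bar>A $$ (i, j)\<bar>" and ?b = "\<Sum>j<dim_col B. \<bar>B $$ (i, j)\<bar>"
  have xc: "x \<in> carrier_vec m" "vec_norm x \<le> 1" and yc: "y \<in> carrier_vec k" "vec_norm y \<le> 1"
    using x y by (auto simp: unit_cube_iff)
  have "?a * vec_norm x \<le> ?a * 1" "?b * vec_norm y \<le> ?b * 1"
    using xc yc by (intro mult_left_mono sum_nonneg; simp)+
  then have "\<bar>(A *\<^sub>v x) $ i\<bar> \<le> ?a" "\<bar>(B *\<^sub>v y) $ i\<bar> \<le> ?b"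
    using abs_mult_mat_vec_le_row_sum[OF A xc(1) i] abs_mult_mat_vec_le_row_sum[OF B yc(1) i]
    by linarith+
  moreover have "(A *\<^sub>v x + B *\<^sub>v y + v) $ i = (A *\<^sub>v x) $ i + (B *\<^sub>v y) $ i + v $ i"
    using A B v i by simp
  ultimately have "\<bar>(A *\<^sub>v x + B *\<^sub>v y + v) $ i\<bar> \<le> ?a + ?b + \<bar>v $ i\<bar>"
    by linarith
  also have "\<dots> = (\<Sum>c\<leftarrow>cols A @ cols B @ [v]. \<bar>c $ i\<bar>)"
    using A B i by (simp add: sum_list_cols)
  also have "\<dots> = (\<Sum>j<dim_col (hconcat3 A B v). \<bar>hconcat3 A B v $$ (i, j)\<bar>)"
    unfolding hconcat3_def using A i by (subst row_sum_mat_of_cols) auto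
  also have "\<dots> \<le> mat_norm (hconcat3 A B v)"
    using A i by (intro row_sum_le_mat_norm) (auto simp: hconcat3_def)
  finally show ?thesis .
qed

section \<open>Activation functions\<close>

lemma sigmoid_less_1: "sigmoid x < 1"
  by (simp add: sigmoid_def divide_less_eq add_pos_pos)

lemma sigmoid_mono: "x \<le> y \<Longrightarrow> sigmoid x \<le> sigmoid y"
  by (simp add: sigmoid_def frac_le add_pos_pos)

lemma sigmoid_minus: "sigmoid (- x) = 1 - sigmoid x"
  by (simp add: sigmoid_def exp_minus field_simps add_pos_pos less_imp_neq[symmetric])

lemma abs_tanh_le: "\<bar>tanh x\<bar> \<le> \<bar>x :: real\<bar>"
proof -
  have nonneg: "tanh y \<le> y" if "0 \<le> y" for y :: real
  proof -
    have "0 - tanh 0 \<le> y - tanh y"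
    proof (rule DERIV_nonneg_imp_nondecreasing[OF that])
      fix z :: real
      have "cosh z \<noteq> 0" by simp
      then have "((\<lambda>t. t - tanh t) has_real_derivative (1 - (1 - tanh z ^ 2))) (at z)"
        by (auto intro!: derivative_eq_intros)
      then show "\<exists>d. ((\<lambda>t. t - tanh t) has_real_derivative d) (at z) \<and> 0 \<le> d"
        by (intro exI conjI) auto
    qed
    then show ?thesis by simp
  qed
  show ?thesis
    using nonneg[of "\<bar>x\<bar>"] by (simp add: tanh_real_abs)
qed

lemma abs_tanh_le_1: "\<bar>tanh x\<bar> \<le> (1 :: real)"
  using tanh_real_bounds[of x] by (auto simp: abs_le_iff)

section \<open>A single layer\<close>

text \<open>The lower bound, which is what makes the layer forget its state at a definite rate, mirrors the
  upper one through \<open>\<sigma>(-x) = 1 - \<sigma>(x)\<close>.\<close>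

lemma forget_gate_bounds:
  assumes net: "mgu_network N" and l: "l \<in> {1..num_layers N}"
    and u: "u \<in> unit_cube (dim_in N l)" and h: "h \<in> unit_cube (dim_h N l)" and i: "i < dim_h N l"
  shows "1 - sigma_f_bar N l \<le> forget_gate N l u h $ i"
    and "forget_gate N l u h $ i \<le> sigma_f_bar N l"
proof -
  let ?m = "mat_norm (hconcat3 (W_f N l) (R_f N l) (b_f N l))"
  let ?z = "W_f N l *\<^sub>v u + R_f N l *\<^sub>v h + b_f N l"
  have N: "W_f N l \<in> carrier_mat (dim_h N l) (dim_in N l)"
    "R_f N l \<in> carrier_mat (dim_h N l) (dim_h N l)" "b_f N l \<in> carrier_vec (dim_h N l)"
    using net l by (auto simp: mgu_network_def)
  have "\<bar>?z $ i\<bar> \<le> ?m"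
    using abs_affine_le_mat_norm_hconcat3[OF N u h i] .
  then have "sigmoid (- ?m) \<le> sigmoid (?z $ i)" "sigmoid (?z $ i) \<le> sigmoid ?m"
    by (auto intro: sigmoid_mono)
  moreover have "forget_gate N l u h $ i = sigmoid (?z $ i)"
    using N i by (simp add: forget_gate_def)
  ultimately show "1 - sigma_f_bar N l \<le> forget_gate N l u h $ i"
    and "forget_gate N l u h $ i \<le> sigma_f_bar N l"
    by (simp_all add: sigma_f_bar_def sigmoid_minus)
qed

lemma dim_layer [simp]:
  assumes "mgu_network N" and "l \<in> {1..num_layers N}"
  shows "dim_vec (forget_gate N l u h) = dim_h N l"
    and "dim_vec (candidate_state N l u h) = dim_h N l"
    and "dim_vec (layer_update N l u h) = dim_h N l"
  using assms
  by (auto simp: mgu_network_def forget_gate_def candidate_state_def layer_update_def hadamard_def)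

lemma layer_update_nth:
  assumes "mgu_network N" and "l \<in> {1..num_layers N}" and "i < dim_h N l"
  shows "layer_update N l u h $ i =
    (1 - forget_gate N l u h $ i) * h $ i + forget_gate N l u h $ i * candidate_state N l u h $ i"
  using assms by (simp add: layer_update_def hadamard_def ones_def)

lemma sigma_f_bar_bounds: "1/2 \<le> sigma_f_bar N l" "sigma_f_bar N l < 1"
proof -
  have "1/2 = sigmoid 0" by (simp add: sigmoid_def)
  also have "\<dots> \<le> sigma_f_bar N l"
    unfolding sigma_f_bar_def by (rule sigmoid_mono) simp
  finally show "1/2 \<le> sigma_f_bar N l" .
qed (simp add: sigma_f_bar_def sigmoid_less_1)

lemma abs_convex_combination_le:
  fixes f :: real
  assumes "0 \<le> f" "f \<le> 1" "\<bar>x\<bar> \<le> a" "\<bar>y\<bar> \<le> b"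
  shows "\<bar>(1 - f) * x + f * y\<bar> \<le> (1 - f) * a + f * b"
proof -
  have "\<bar>(1 - f) * x + f * y\<bar> \<le> (1 - f) * \<bar>x\<bar> + f * \<bar>y\<bar>"
    using assms by (intro order_trans[OF abs_triangle_ineq]) (simp add: abs_mult)
  also have "\<dots> \<le> (1 - f) * a + f * b"
    using assms by (intro add_mono mult_left_mono) auto
  finally show ?thesis .
qed

text \<open>Each new component is a convex combination of a component of \<open>h\<close> and a value of \<open>tanh\<close>.\<close>

lemma layer_update_unit_cube:
  assumes net: "mgu_network N" and l: "l \<in> {1..num_layers N}"
    and u: "u \<in> unit_cube (dim_in N l)" and h: "h \<in> unit_cube (dim_h N l)"
  shows "layer_update N l u h \<in> unit_cube (dim_h N l)"
proof -
  have "\<bar>layer_update N l u h $ i\<bar> \<le> 1" if i: "i < dim_h N l" for i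
  proof -
    have f: "0 \<le> forget_gate N l u h $ i" "forget_gate N l u h $ i \<le> 1"
      using forget_gate_bounds[OF net l u h i] sigma_f_bar_bounds[of N l] by linarith+
    have hi: "\<bar>h $ i\<bar> \<le> 1"
      using h i by (auto simp: unit_cube_def abs_le_iff minus_le_iff)
    have ci: "\<bar>candidate_state N l u h $ i\<bar> \<le> 1"
    proof -
      have "dim_vec (b_h N l) = dim_h N l" using net l by (auto simp: mgu_network_def)
      then show ?thesis using i by (simp add: candidate_state_def abs_tanh_le_1)
    qed
    show ?thesis
      using abs_convex_combination_le[OF f hi ci] layer_update_nth[OF net l i] by simp
  qed
  then have "vec_norm (layer_update N l u h) \<le> 1"
    by (intro vec_norm_leI) (simp_all add: dim_layer(3)[OF net l])
  with dim_layer(3)[OF net l] show ?thesis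
    by (auto simp: unit_cube_iff intro: carrier_vecI)
qed

text \<open>The contraction factor left after bounding the gate below by \<open>1 - sigma_f_bar\<close> and the
  feedback through the candidate state by \<open>sigma_f_bar\<close> times the norm of \<open>R_h\<close>.\<close>

definition layer_rate :: "mgu \<Rightarrow> nat \<Rightarrow> real" where
  "layer_rate N l = 1 - (1 - sigma_f_bar N l) * (1 - sigma_f_bar N l * mat_norm (R_h N l))"

lemma candidate_state_le:
  assumes net: "mgu_network N" and l: "l \<in> {1..num_layers N}"
    and u: "u \<in> unit_cube (dim_in N l)" and h: "h \<in> unit_cube (dim_h N l)" and i: "i < dim_h N l"
  shows "\<bar>candidate_state N l u h $ i\<bar> \<le> mat_norm (W_h N l) * vec_norm u
    + mat_norm (R_h N l) * (sigma_f_bar N l * vec_norm h) + vec_norm (b_h N l)"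
proof -
  let ?fh = "forget_gate N l u h \<circ>\<^sub>h h"
  have N: "W_h N l \<in> carrier_mat (dim_h N l) (dim_in N l)"
    "R_h N l \<in> carrier_mat (dim_h N l) (dim_h N l)" "b_h N l \<in> carrier_vec (dim_h N l)"
    using net l by (auto simp: mgu_network_def)
  have uc: "u \<in> carrier_vec (dim_in N l)" and hc: "h \<in> carrier_vec (dim_h N l)"
    using u h by (auto simp: unit_cube_iff)
  have fhc: "?fh \<in> carrier_vec (dim_h N l)"
    using net l by (simp add: hadamard_def)
  have "vec_norm ?fh \<le> sigma_f_bar N l * vec_norm h"
  proof (rule vec_norm_leI)
    fix j assume "j < dim_vec ?fh"
    then have j: "j < dim_h N l" using fhc by simp
    have "\<bar>forget_gate N l u h $ j\<bar> \<le> sigma_f_bar N l"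
      using forget_gate_bounds[OF net l u h j] sigma_f_bar_bounds[of N l] by linarith
    moreover have "\<bar>h $ j\<bar> \<le> vec_norm h"
      using hc j by (intro abs_index_le_vec_norm) simp
    ultimately have "\<bar>forget_gate N l u h $ j\<bar> * \<bar>h $ j\<bar> \<le> sigma_f_bar N l * vec_norm h"
      by (intro mult_mono) auto
    then show "\<bar>?fh $ j\<bar> \<le> sigma_f_bar N l * vec_norm h"
      using j net l by (simp add: hadamard_def abs_mult)
  qed (use sigma_f_bar_bounds(1)[of N l] in simp)
  then have "mat_norm (R_h N l) * vec_norm ?fh \<le> mat_norm (R_h N l) * (sigma_f_bar N l * vec_norm h)"
    by (intro mult_left_mono) auto
  moreover note abs_mult_mat_vec_le[OF N(1) uc i] abs_mult_mat_vec_le[OF N(2) fhc i]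
    abs_index_le_vec_norm[of i "b_h N l"]
  moreover have "(W_h N l *\<^sub>v u + R_h N l *\<^sub>v ?fh + b_h N l) $ i =
      (W_h N l *\<^sub>v u) $ i + (R_h N l *\<^sub>v ?fh) $ i + b_h N l $ i"
    using N i by simp
  moreover have "candidate_state N l u h $ i = tanh ((W_h N l *\<^sub>v u + R_h N l *\<^sub>v ?fh + b_h N l) $ i)"
    using N i by (simp add: candidate_state_def)
  moreover note abs_tanh_le[of "(W_h N l *\<^sub>v u + R_h N l *\<^sub>v ?fh + b_h N l) $ i"]
  ultimately show ?thesis
    using N(3) i by simp
qed

text \<open>The factor \<open>1 - f (1 - s r)\<close> of \<open>\<parallel>h\<parallel>\<close> decreases in the gate value \<open>f\<close> as long as \<open>s r \<le> 1\<close>, so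
  the worst case is the smallest gate value \<open>1 - s\<close>.\<close>

lemma layer_update_le:
  assumes net: "mgu_network N" and l: "l \<in> {1..num_layers N}"
    and u: "u \<in> unit_cube (dim_in N l)" and h: "h \<in> unit_cube (dim_h N l)"
    and small: "sigma_f_bar N l * mat_norm (R_h N l) \<le> 1"
  shows "vec_norm (layer_update N l u h)
    \<le> layer_rate N l * vec_norm h + mat_norm (W_h N l) * vec_norm u + vec_norm (b_h N l)"
proof -
  define s r where "s = sigma_f_bar N l" and "r = mat_norm (R_h N l)"
  define c where "c = mat_norm (W_h N l) * vec_norm u + vec_norm (b_h N l)"
  have c: "0 \<le> c" by (simp add: c_def)
  have s: "1/2 \<le> s" "s < 1" using sigma_f_bar_bounds by (auto simp: s_def)
  have sr: "0 \<le> s * r" "s * r \<le> 1" using small s by (auto simp: s_def r_def)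
  have "vec_norm (layer_update N l u h) \<le> (1 - (1 - s) * (1 - s * r)) * vec_norm h + c"
  proof (rule vec_norm_leI)
    have "(1 - s) * (1 - s * r) \<le> 1 * 1" using s sr by (intro mult_mono) auto
    then show "0 \<le> (1 - (1 - s) * (1 - s * r)) * vec_norm h + c" using c by simp
  next
    fix i assume "i < dim_vec (layer_update N l u h)"
    then have i: "i < dim_h N l" using net l by simp
    let ?f = "forget_gate N l u h $ i"
    have f: "1 - s \<le> ?f" "0 \<le> ?f" "?f \<le> 1"
      using forget_gate_bounds[OF net l u h i] s by (auto simp: s_def)
    have hi: "\<bar>h $ i\<bar> \<le> vec_norm h"
      using h i by (intro abs_index_le_vec_norm) (auto simp: unit_cube_iff)
    have ci: "\<bar>candidate_state N l u h $ i\<bar> \<le> s * r * vec_norm h + c"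
      using candidate_state_le[OF net l u h i] by (simp add: s_def r_def c_def algebra_simps)
    have "\<bar>layer_update N l u h $ i\<bar> \<le> (1 - ?f) * vec_norm h + ?f * (s * r * vec_norm h + c)"
      using abs_convex_combination_le[OF f(2,3) hi ci] layer_update_nth[OF net l i] by simp
    also have "\<dots> = (1 - ?f * (1 - s * r)) * vec_norm h + ?f * c"
      by (simp add: algebra_simps)
    also have "\<dots> \<le> (1 - (1 - s) * (1 - s * r)) * vec_norm h + 1 * c"
      using f sr c by (intro add_mono mult_right_mono diff_left_mono) auto
    finally show "\<bar>layer_update N l u h $ i\<bar> \<le> (1 - (1 - s) * (1 - s * r)) * vec_norm h + c"
      by simp
  qed
  then show ?thesis
    by (simp add: layer_rate_def s_def r_def c_def)
qed

text \<open>Dropping the nonnegative term with \<open>R_f\<close> leaves \<open>s (s r) < 1 - s\<close>, and \<open>1 - s \<le> s\<close> since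
  \<open>s \<ge> 1/2\<close>.\<close>

lemma delta_ISS_condition_imp_rate:
  assumes "sigma_f_bar N l + (sigma_f_bar N l)\<^sup>2 * mat_norm (R_h N l)
    + 1/4 * mat_norm (R_f N l) * (sigma_f_bar N l * mat_norm (R_h N l) + phi_h_bar N l + 1) < 1"
  shows "sigma_f_bar N l * mat_norm (R_h N l) < 1" and "layer_rate N l < 1"
proof -
  let ?s = "sigma_f_bar N l" and ?r = "mat_norm (R_h N l)"
  note s = sigma_f_bar_bounds[of N l]
  have "0 \<le> phi_h_bar N l" by (simp add: phi_h_bar_def)
  then have "0 \<le> 1/4 * mat_norm (R_f N l) * (?s * ?r + phi_h_bar N l + 1)"
    using s by simp
  with assms have "?s * (?s * ?r) < 1 - ?s"
    unfolding power2_eq_square mult.assoc by linarith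
  also have "1 - ?s \<le> ?s * 1" using s by simp
  finally show *: "?s * ?r < 1"
    using s by (subst (asm) mult_less_cancel_left_pos) auto
  have "0 < (1 - ?s) * (1 - ?s * ?r)" using * s by simp
  then show "layer_rate N l < 1" by (simp add: layer_rate_def)
qed

section \<open>Cascades of scalar inequalities\<close>

text \<open>The constant term is the fixed point of \<open>t \<mapsto> \<mu> t + d\<close>.\<close>

lemma affine_recursion_le:
  fixes V :: "nat \<Rightarrow> real"
  assumes "0 \<le> \<mu>" "\<mu> < 1" "0 \<le> d"
    and "\<And>k. k < K \<Longrightarrow> V (Suc k) \<le> \<mu> * V k + d"
  shows "V K \<le> \<mu> ^ K * V 0 + d / (1 - \<mu>)"
  using assms(4)
proof (induction K)
  case 0
  show ?case using assms by simp
next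
  case (Suc K)
  have "V (Suc K) \<le> \<mu> * V K + d" using Suc.prems by simp
  also have "\<dots> \<le> \<mu> * (\<mu> ^ K * V 0 + d / (1 - \<mu>)) + d"
    using assms Suc by (intro add_right_mono mult_left_mono) auto
  also have "\<dots> = \<mu> ^ Suc K * V 0 + d / (1 - \<mu>)"
    using assms by (simp add: field_simps)
  finally show ?case .
qed

text \<open>
  Here \<open>x k l\<close> stands for the norm of layer \<open>l\<close> at time \<open>k\<close>, and \<open>x (k + 1) 0\<close> for the norm of the
  input read at time \<open>k\<close>. For \<open>V k = (\<Sum>l=1..L. e\<^sup>l x k l)\<close> the coupling terms sum to at most
  \<open>a e (v + V (k + 1))\<close>: shifting the layer index costs one factor \<open>e\<close>. For \<open>a e \<le> (1 - \<rho>) / 2\<close>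
  this can be moved to the left-hand side, and \<open>V\<close> still contracts, with factor
  \<open>2 \<rho> / (1 + \<rho>) < 1\<close>. The constants depend on \<open>\<rho>\<close>, \<open>a\<close> and \<open>L\<close> only, which is the
  uniformity in states, inputs and biases that comparison functions require.
\<close>

lemma cascade_bound:
  fixes \<rho> a :: real
  assumes lam: "0 < \<rho>" "\<rho> < 1" and a: "0 \<le> a" and L: "1 \<le> L"
  obtains \<mu> C D where "0 < \<mu>" "\<mu> < 1" "0 < C" "0 < D"
    and "\<And>(x :: nat \<Rightarrow> nat \<Rightarrow> real) K v \<beta> r l.
      \<lbrakk>\<And>k l. 0 \<le> x k l; 0 \<le> v; 0 \<le> \<beta>; \<And>l. l \<in> {1..L} \<Longrightarrow> x 0 l \<le> r;
       \<And>k. k < K \<Longrightarrow> x (Suc k) 0 \<le> v;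
       \<And>k l. \<lbrakk>k < K; l \<in> {1..L}\<rbrakk> \<Longrightarrow> x (Suc k) l \<le> \<rho> * x k l + a * x (Suc k) (l - 1) + \<beta>;
       l \<in> {1..L}\<rbrakk> \<Longrightarrow> x K l \<le> C * \<mu> ^ K * r + D * (v + \<beta>)"
proof -
  define e where "e = (1 - \<rho>) / (2 * (a + 1))"
  define \<mu> where "\<mu> = 2 * \<rho> / (1 + \<rho>)"
  have e0: "0 < e" using lam a by (simp add: e_def)
  have ae: "a * e \<le> (1 - \<rho>) / 2"
    using lam a by (simp add: e_def field_simps mult_left_mono)
  have e1: "e \<le> 1"
  proof -
    have "1 - \<rho> \<le> 2 * (a + 1)" using lam a by (simp add: algebra_simps)
    then show ?thesis using a by (simp add: e_def divide_le_eq)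
  qed
  have mu: "0 < \<mu>" "\<mu> < 1" using lam by (auto simp: \<mu>_def field_simps)
  \<comment> \<open>\<open>V 0 \<le> L * r\<close>, and passing from \<open>V\<close> back to one layer costs at most a factor \<open>1 / e ^ L\<close>.\<close>
  define C D where "C = L / e ^ L" and "D = 2 * L / (1 - \<mu>) / e ^ L"
  show ?thesis
  proof (rule that[OF mu])
    show "0 < C" "0 < D" using e0 mu L by (auto simp: C_def D_def)
  next
    fix x :: "nat \<Rightarrow> nat \<Rightarrow> real" and K v \<beta> r l
    assume nonneg: "\<And>k l. 0 \<le> x k l" and v: "0 \<le> v" and \<beta>: "0 \<le> \<beta>"
      and init: "\<And>l. l \<in> {1..L} \<Longrightarrow> x 0 l \<le> r"
      and inp: "\<And>k. k < K \<Longrightarrow> x (Suc k) 0 \<le> v"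
      and step: "\<And>k l. \<lbrakk>k < K; l \<in> {1..L}\<rbrakk> \<Longrightarrow>
        x (Suc k) l \<le> \<rho> * x k l + a * x (Suc k) (l - 1) + \<beta>"
      and l: "l \<in> {1..L}"
    define V where "V k = (\<Sum>l=1..L. e ^ l * x k l)" for k
    have el: "e ^ l \<le> 1" for l :: nat using e0 e1 by (intro power_le_one) auto
    have V_step: "V (Suc k) \<le> \<mu> * V k + 2 * L * (v + \<beta>)" if k: "k < K" for k
    proof -
      have "(\<Sum>l=1..L. e ^ l * x (Suc k) (l - 1)) = (\<Sum>l<L. e ^ Suc l * x (Suc k) l)"
        by (rule sum.reindex_bij_witness[of _ Suc "\<lambda>l. l - 1"]) auto
      also have "\<dots> \<le> (\<Sum>l\<in>insert 0 {1..L}. e ^ Suc l * x (Suc k) l)"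
        using e0 nonneg by (intro sum_mono2) auto
      also have "\<dots> = e * (x (Suc k) 0 + V (Suc k))"
        by (simp add: V_def sum_distrib_left algebra_simps)
      also have "\<dots> \<le> e * (v + V (Suc k))"
        using inp[OF k] e0 by simp
      finally have shift: "(\<Sum>l=1..L. e ^ l * x (Suc k) (l - 1)) \<le> e * (v + V (Suc k))" .
      have V0: "0 \<le> V (Suc k)" unfolding V_def using e0 nonneg by (intro sum_nonneg) auto
      have "V (Suc k) \<le> (\<Sum>l=1..L. e ^ l * (\<rho> * x k l + a * x (Suc k) (l - 1) + \<beta>))"
        unfolding V_def using e0 step[OF k] by (intro sum_mono mult_left_mono) auto
      also have "\<dots> = \<rho> * V k + a * (\<Sum>l=1..L. e ^ l * x (Suc k) (l - 1)) + (\<Sum>l=1..L. e ^ l * \<beta>)"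
        by (simp add: V_def sum.distrib sum_distrib_left algebra_simps)
      also have "\<dots> \<le> \<rho> * V k + a * (e * (v + V (Suc k))) + (\<Sum>l=1..L. 1 * \<beta>)"
        using shift lam a el \<beta> by (intro add_mono mult_left_mono sum_mono mult_right_mono) auto
      also have "\<dots> = \<rho> * V k + a * e * (v + V (Suc k)) + L * \<beta>" by simp
      also have "\<dots> \<le> \<rho> * V k + (1 - \<rho>) / 2 * (v + V (Suc k)) + L * \<beta>"
        using ae v V0 by (intro add_right_mono add_left_mono mult_right_mono) auto
      finally have "(1 + \<rho>) / 2 * V (Suc k) \<le> \<rho> * V k + (1 - \<rho>) / 2 * v + L * \<beta>"
        by (simp add: field_simps)
      also have "(1 - \<rho>) / 2 * v \<le> L * v"
        using lam L v by (intro mult_right_mono) auto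
      finally have "(1 + \<rho>) * V (Suc k) \<le> 2 * \<rho> * V k + 2 * L * (v + \<beta>)"
        by (simp add: algebra_simps)
      also have "\<dots> \<le> 2 * \<rho> * V k + (1 + \<rho>) * (2 * L * (v + \<beta>))"
        using lam v \<beta> mult_right_mono[of 1 "1 + \<rho>" "2 * L * (v + \<beta>)"] by simp
      finally have "(1 + \<rho>) * V (Suc k) \<le> (1 + \<rho>) * (\<mu> * V k + 2 * L * (v + \<beta>))"
        using lam by (simp add: \<mu>_def distrib_left)
      then show ?thesis using lam by simp
    qed
    have "V 0 \<le> (\<Sum>l=1..L. 1 * r)"
      unfolding V_def using init el nonneg by (intro sum_mono mult_mono) auto
    then have V0: "V 0 \<le> L * r" by simp
    have "e ^ L * x K l \<le> e ^ l * x K l"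
      using l e0 e1 nonneg by (intro mult_right_mono power_decreasing) auto
    also have "\<dots> \<le> V K"
      unfolding V_def using l e0 nonneg by (intro member_le_sum) auto
    also have "\<dots> \<le> \<mu> ^ K * V 0 + 2 * L * (v + \<beta>) / (1 - \<mu>)"
      using mu v \<beta> V_step by (intro affine_recursion_le) auto
    also have "\<dots> \<le> \<mu> ^ K * (L * r) + 2 * L * (v + \<beta>) / (1 - \<mu>)"
      using mu V0 by simp
    also have "\<dots> = \<mu> ^ K * ((e ^ L * C) * r) + (e ^ L * D) * (v + \<beta>)"
      using e0 by (simp add: C_def D_def)
    also have "\<dots> = e ^ L * (C * \<mu> ^ K * r + D * (v + \<beta>))"
      by (simp add: algebra_simps)
    finally show "x K l \<le> C * \<mu> ^ K * r + D * (v + \<beta>)"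
      using e0 by simp
  qed
qed

section \<open>Linear comparison functions\<close>

lemma linear_class_K:
  assumes "0 < c"
  shows "(\<lambda>r. c * r) \<in> class_K"
  using assms by (auto simp: class_K_def strict_mono_on_def intro!: continuous_intros)

lemma linear_class_K_inf:
  assumes "0 < c"
  shows "(\<lambda>r. c * r) \<in> class_K_inf"
  using assms linear_class_K[OF assms]
  by (auto simp: class_K_inf_def intro!: filterlim_tendsto_pos_mult_at_top[OF tendsto_const] filterlim_ident)

text \<open>Time is discrete, so continuity in \<open>k\<close> is automatic and joint continuity reduces to continuity
  in \<open>r\<close>.\<close>

lemma geometric_class_KL:
  assumes "0 < C" "0 < \<mu>" "\<mu> < 1"
  shows "(\<lambda>r k. C * \<mu> ^ k * r) \<in> class_KL"
proof -
  have "continuous_on ({0..} \<times> UNIV) (\<lambda>p :: real \<times> nat. \<mu> ^ snd p)"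
    by (rule continuous_on_compose2[OF continuous_on_discrete[of UNIV "\<lambda>k. \<mu> ^ k"]])
       (auto intro: continuous_intros)
  then have "continuous_on ({0..} \<times> UNIV) (\<lambda>(r, k). C * \<mu> ^ k * r)"
    unfolding case_prod_unfold by (intro continuous_intros)
  moreover have "(\<lambda>r. C * \<mu> ^ k * r) \<in> class_K" for k
    using assms by (intro linear_class_K) simp
  moreover have "C * \<mu> ^ k * r < C * \<mu> ^ j * r" if "0 < r" "j < k" for r and j k :: nat
    using assms that power_strict_decreasing[of j k \<mu>] by simp
  moreover have "(\<lambda>k. C * \<mu> ^ k * r) \<longlonglongrightarrow> 0" for r
  proof -
    have "(\<lambda>k. C * \<mu> ^ k * r) \<longlonglongrightarrow> C * 0 * r"
      using assms by (intro tendsto_intros LIMSEQ_realpow_zero) auto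
    then show ?thesis by simp
  qed
  ultimately show ?thesis by (auto simp: class_KL_def)
qed

section \<open>The state space\<close>

lemma compact_vecs_unit_cube: "compact_vecs n (unit_cube n)"
proof -
  have "(\<lambda>v. restrict (($) v) {..<n}) ` unit_cube n = PiE {..<n} (\<lambda>_. {-1..1 :: real})"
  proof (intro equalityI subsetI)
    fix g assume g: "g \<in> PiE {..<n} (\<lambda>_. {-1..1 :: real})"
    then have "vec n g \<in> unit_cube n"
      by (auto simp: unit_cube_def PiE_iff)
    moreover have "g = restrict (($) (vec n g)) {..<n}"
      using g by (auto simp: PiE_iff extensional_def restrict_def fun_eq_iff)
    ultimately show "g \<in> (\<lambda>v. restrict (($) v) {..<n}) ` unit_cube n" by blast
  qed (auto simp: unit_cube_def PiE_iff)
  then show ?thesis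
    unfolding compact_vecs_def by (auto simp: unit_cube_def compactin_PiE)
qed

lemma dim_upto_mono: "l \<le> m \<Longrightarrow> dim_upto N l \<le> dim_upto N m"
  unfolding dim_upto_def by (rule sum_mono2) auto

lemma dim_upto_step: "1 \<le> l \<Longrightarrow> dim_upto N l = dim_upto N (l - 1) + dim_h N l"
  by (cases l) (simp_all add: dim_upto_def)

text \<open>The blocks cover all indices: \<open>l\<close> is the first layer whose cumulative dimension exceeds \<open>i\<close>.\<close>

lemma index_in_block:
  assumes "i < dim_upto N L"
  obtains l j where "l \<in> {1..L}" "j < dim_h N l" "i = dim_upto N (l - 1) + j"
proof -
  define l where "l = (LEAST l. i < dim_upto N l)"
  have l: "i < dim_upto N l" "l \<le> L"
    using assms unfolding l_def by (auto intro: LeastI Least_le)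
  have "l \<noteq> 0"
  proof
    assume "l = 0"
    with l show False by (simp add: dim_upto_def)
  qed
  then have "dim_upto N (l - 1) \<le> i"
    using not_less_Least[of "l - 1" "\<lambda>l. i < dim_upto N l"] by (auto simp: l_def)
  with l \<open>l \<noteq> 0\<close> show thesis
    using dim_upto_step[of l N] by (intro that[of l "i - dim_upto N (l - 1)"]) auto
qed

lemma dim_block [simp]: "dim_vec (block N l x) = dim_h N l"
  by (simp add: block_def)

lemma vec_norm_block_le:
  assumes "x \<in> carrier_vec (dim_state N)" "l \<in> {1..num_layers N}"
  shows "vec_norm (block N l x) \<le> vec_norm x"
proof (rule vec_norm_leI)
  fix i assume "i < dim_vec (block N l x)"
  then have i: "i < dim_h N l" by simp
  then have "dim_upto N (l - 1) + i < dim_state N"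
    using assms dim_upto_step[of l N] dim_upto_mono[of l "num_layers N" N] by (simp add: dim_state_def)
  then show "\<bar>block N l x $ i\<bar> \<le> vec_norm x"
    using assms i by (simp add: block_def abs_index_le_vec_norm)
qed simp

lemma vec_norm_le_blocks:
  assumes "x \<in> carrier_vec (dim_state N)" "0 \<le> c"
    and "\<And>l. l \<in> {1..num_layers N} \<Longrightarrow> vec_norm (block N l x) \<le> c"
  shows "vec_norm x \<le> c"
proof (rule vec_norm_leI)
  fix i assume "i < dim_vec x"
  then have "i < dim_upto N (num_layers N)" using assms by (simp add: dim_state_def)
  then obtain l j where lj: "l \<in> {1..num_layers N}" "j < dim_h N l" "i = dim_upto N (l - 1) + j"
    by (rule index_in_block)
  then have "\<bar>x $ i\<bar> = \<bar>block N l x $ j\<bar>" by (simp add: block_def)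
  also have "\<dots> \<le> c"
    using abs_index_le_vec_norm[of j "block N l x"] assms(3)[OF lj(1)] lj(2) by simp
  finally show "\<bar>x $ i\<bar> \<le> c" .
qed (use assms in simp)

text \<open>A vector lies in the unit cube iff its infinity norm is at most \<open>1\<close>, and the infinity norm of a
  stacked vector is the maximum over its blocks.\<close>

lemma H_inv_eq_unit_cube: "H_inv N = unit_cube (dim_state N)"
proof (intro equalityI subsetI)
  fix x assume "x \<in> H_inv N"
  then show "x \<in> unit_cube (dim_state N)"
    by (auto simp: H_inv_def unit_cube_iff intro: vec_norm_le_blocks)
next
  fix x assume "x \<in> unit_cube (dim_state N)"
  then show "x \<in> H_inv N"
    unfolding H_inv_def unit_cube_iff
    by (auto intro: carrier_vecI order_trans[OF vec_norm_block_le[of x N]])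
qed

section \<open>The network\<close>

lemma next_hidden_unit_cube:
  assumes net: "mgu_network N" and h: "h \<in> H_inv N" and u: "u \<in> unit_cube (dim_u N)"
    and "l \<le> num_layers N"
  shows "next_hidden N h u l \<in> unit_cube (dim_in N (Suc l))"
  using \<open>l \<le> num_layers N\<close>
proof (induction l)
  case 0
  show ?case using u by (simp add: dim_in_def)
next
  case (Suc l)
  then have "layer_update N (Suc l) (next_hidden N h u l) (block N (Suc l) h)
      \<in> unit_cube (dim_h N (Suc l))"
    using h by (intro layer_update_unit_cube[OF net]) (auto simp: H_inv_def)
  then show ?case by (simp add: dim_in_def)
qed

lemma next_hidden_carrier:
  assumes "mgu_network N"
  shows "\<forall>l \<in> {1..num_layers N}. next_hidden N h u l \<in> carrier_vec (dim_h N l)"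
proof
  fix l assume "l \<in> {1..num_layers N}"
  then show "next_hidden N h u l \<in> carrier_vec (dim_h N l)"
    using assms by (cases l) (auto intro: carrier_vecI)
qed

lemma block_mgu_map:
  assumes "mgu_network N" "l \<in> {1..num_layers N}"
  shows "block N l (mgu_map N h u) = next_hidden N h u l"
  unfolding mgu_map_def by (rule block_stack[OF next_hidden_carrier]) (use assms in auto)

lemma mgu_map_H_inv:
  assumes net: "mgu_network N" and h: "h \<in> H_inv N" and u: "u \<in> unit_cube (dim_u N)"
  shows "mgu_map N h u \<in> H_inv N"
proof -
  have "mgu_map N h u \<in> carrier_vec (dim_state N)"
    unfolding mgu_map_def dim_state_def by (rule stack_carrier[OF next_hidden_carrier[OF net]])
  moreover have "block N l (mgu_map N h u) \<in> unit_cube (dim_h N l)" if "l \<in> {1..num_layers N}" for l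
    using next_hidden_unit_cube[OF net h u, of l] block_mgu_map[OF net that] that
    by (simp add: dim_in_def)
  ultimately show ?thesis by (simp add: H_inv_def)
qed

lemma trajectory_invariant:
  assumes "forward_invariant w X U" "x \<in> X" "\<And>z. z < k \<Longrightarrow> u z \<in> U"
  shows "trajectory w x u k \<in> X"
  using assms(3)
proof (induction k)
  case 0
  show ?case using assms by simp
next
  case (Suc k)
  then show ?case using assms(1) by (simp add: forward_invariant_def)
qed

lemma block_mgu_map_le:
  assumes net: "mgu_network N" and h: "h \<in> H_inv N" and u: "u \<in> unit_cube (dim_u N)"
    and l: "l \<in> {1..num_layers N}"
    and small: "sigma_f_bar N l * mat_norm (R_h N l) \<le> 1"
  shows "vec_norm (block N l (mgu_map N h u)) \<le> layer_rate N l * vec_norm (block N l h)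
    + mat_norm (W_h N l) * vec_norm (next_hidden N h u (l - 1)) + vec_norm (b_h N l)"
proof -
  obtain m where m: "l = Suc m" using l by (cases l) auto
  have "vec_norm (layer_update N l (next_hidden N h u m) (block N l h)) \<le>
      layer_rate N l * vec_norm (block N l h) + mat_norm (W_h N l) * vec_norm (next_hidden N h u m)
      + vec_norm (b_h N l)"
    using h l m next_hidden_unit_cube[OF net h u, of m]
    by (intro layer_update_le[OF net l _ _ small]) (auto simp: H_inv_def)
  then show ?thesis
    using block_mgu_map[OF net l] by (simp add: m)
qed

lemma with_bias_simps [simp]:
  "num_layers (with_bias N b) = num_layers N" "dim_u (with_bias N b) = dim_u N"
  "dim_h (with_bias N b) = dim_h N" "W_h (with_bias N b) = W_h N" "R_h (with_bias N b) = R_h N"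
  "b_h (with_bias N b) l = block N l b"
  "sigma_f_bar (with_bias N b) = sigma_f_bar N" "layer_rate (with_bias N b) = layer_rate N"
  "dim_upto (with_bias N b) = dim_upto N" "block (with_bias N b) = block N"
  "dim_state (with_bias N b) = dim_state N" "H_inv (with_bias N b) = H_inv N"
  by (auto simp: with_bias_def sigma_f_bar_def layer_rate_def fun_eq_iff dim_upto_def block_def
      dim_state_def H_inv_def)

lemma mgu_network_with_bias: "mgu_network N \<Longrightarrow> mgu_network (with_bias N b)"
  by (auto simp: mgu_network_def with_bias_def dim_in_def intro: carrier_vecI)

lemma vec_norm_le_max_input:
  assumes "z < k"
  shows "vec_norm (u z) \<le> max_input u k"
  using assms by (auto simp: max_input_def)

lemma max_input_nonneg: "0 \<le> max_input u k"
  using order_trans[OF vec_norm_nonneg vec_norm_le_max_input[of 0 k u]]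
  by (cases "k = 0") (auto simp: max_input_def)

text \<open>Including \<open>1/2\<close> in the maximum keeps the common rate positive, as strict monotonicity of
  \<open>\<K>\<L>\<close> functions in time requires.\<close>

lemma uniform_layer_constants:
  assumes "\<forall>l \<in> {1..num_layers N}. layer_rate N l < 1"
  obtains \<rho> a where "0 < \<rho>" "\<rho> < 1" "0 \<le> a"
    and "\<And>l. l \<in> {1..num_layers N} \<Longrightarrow> layer_rate N l \<le> \<rho>"
    and "\<And>l. l \<in> {1..num_layers N} \<Longrightarrow> mat_norm (W_h N l) \<le> a"
proof
  let ?\<rho> = "Max (insert (1/2) (layer_rate N ` {1..num_layers N}))"
  let ?a = "Max (insert 0 ((\<lambda>l. mat_norm (W_h N l)) ` {1..num_layers N}))"
  have "1/2 \<le> ?\<rho>" by (rule Max_ge) auto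
  then show "0 < ?\<rho>" by linarith
  show "?\<rho> < 1" using assms by (subst Max_less_iff) auto
  show "0 \<le> ?a" by (rule Max_ge) auto
  show "layer_rate N l \<le> ?\<rho>" "mat_norm (W_h N l) \<le> ?a" if "l \<in> {1..num_layers N}" for l
    using that by (intro Max_ge; simp)+
qed

theorem proposition3:
  fixes N :: mgu
  assumes "mgu_network N"
    and "\<forall>l \<in> {1..num_layers N}.
      sigma_f_bar N l + (sigma_f_bar N l)\<^sup>2 * mat_norm (R_h N l)
        + 1/4 * mat_norm (R_f N l) * (sigma_f_bar N l * mat_norm (R_h N l) + phi_h_bar N l + 1) < 1"
  shows "mgu_ISS N (H_inv N) (unit_cube (dim_u N))"
proof -
  let ?w = "\<lambda>b. mgu_map (with_bias N b)" and ?U = "unit_cube (dim_u N)"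
  have small: "sigma_f_bar N l * mat_norm (R_h N l) \<le> 1" and rate: "layer_rate N l < 1"
    if "l \<in> {1..num_layers N}" for l
    using delta_ISS_condition_imp_rate[of N l] assms(2) that by auto
  have net: "mgu_network (with_bias N b)" for b
    using assms(1) by (rule mgu_network_with_bias)
  have inv: "forward_invariant (?w b) (H_inv N) ?U" for b
    using mgu_map_H_inv[OF net[of b]] by (simp add: forward_invariant_def)
  obtain \<rho> a where lam: "0 < \<rho>" "\<rho> < 1" "0 \<le> a"
    and le_lam: "\<And>l. l \<in> {1..num_layers N} \<Longrightarrow> layer_rate N l \<le> \<rho>"
    and le_a: "\<And>l. l \<in> {1..num_layers N} \<Longrightarrow> mat_norm (W_h N l) \<le> a"
    using uniform_layer_constants[of N] rate by blast
  have L: "1 \<le> num_layers N" using assms(1) by (simp add: mgu_network_def)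
  obtain \<mu> C D where mu: "0 < \<mu>" "\<mu> < 1" and CD: "0 < C" "0 < D"
    and cascade: "\<And>(x :: nat \<Rightarrow> nat \<Rightarrow> real) K v \<beta> r l.
      \<lbrakk>\<And>k l. 0 \<le> x k l; 0 \<le> v; 0 \<le> \<beta>; \<And>l. l \<in> {1..num_layers N} \<Longrightarrow> x 0 l \<le> r;
       \<And>k. k < K \<Longrightarrow> x (Suc k) 0 \<le> v;
       \<And>k l. \<lbrakk>k < K; l \<in> {1..num_layers N}\<rbrakk> \<Longrightarrow>
         x (Suc k) l \<le> \<rho> * x k l + a * x (Suc k) (l - 1) + \<beta>;
       l \<in> {1..num_layers N}\<rbrakk> \<Longrightarrow> x K l \<le> C * \<mu> ^ K * r + D * (v + \<beta>)"
    using cascade_bound[OF lam L] by blast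
  have bound: "vec_norm (trajectory (?w b) x\<^sub>0 u k)
      \<le> C * \<mu> ^ k * vec_norm x\<^sub>0 + D * max_input u k + D * vec_norm b"
    if x0: "x\<^sub>0 \<in> H_inv N" and u: "\<forall>z<k. u z \<in> ?U" and b: "b \<in> carrier_vec (dim_state N)"
    for k x\<^sub>0 u b
  proof -
    define h where "h = trajectory (?w b) x\<^sub>0 u"
    have h: "h j \<in> H_inv N" if "j \<le> k" for j
      unfolding h_def using that u by (intro trajectory_invariant[OF inv x0]) auto
    \<comment> \<open>As layer \<open>0\<close> at time \<open>j + 1\<close> stands the input read at time \<open>j\<close>: the updated layer \<open>1\<close> is
      driven by this input just as layer \<open>l\<close> is by the updated layer \<open>l - 1\<close>.\<close>
    define x where "x j l = (if l = 0 then vec_norm (u (j - 1)) else vec_norm (block N l (h j)))"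
      for j l :: nat
    have blocks: "vec_norm (block N l (h k)) \<le> C * \<mu> ^ k * vec_norm x\<^sub>0 + D * (max_input u k + vec_norm b)"
      if l: "l \<in> {1..num_layers N}" for l
    proof -
      have "x k l \<le> C * \<mu> ^ k * vec_norm x\<^sub>0 + D * (max_input u k + vec_norm b)"
      proof (rule cascade)
        show "0 \<le> x j m" for j m by (simp add: x_def)
        show "x 0 m \<le> vec_norm x\<^sub>0" if "m \<in> {1..num_layers N}" for m
          using that x0 vec_norm_block_le[of x\<^sub>0 N m] by (simp add: x_def h_def H_inv_def)
        show "x (Suc j) 0 \<le> max_input u k" if "j < k" for j
          using vec_norm_le_max_input[OF that] by (simp add: x_def)
        show "x (Suc j) m \<le> \<rho> * x j m + a * x (Suc j) (m - 1) + vec_norm b"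
          if j: "j < k" and m: "m \<in> {1..num_layers N}" for j m
        proof -
          have step: "h (Suc j) = ?w b (h j) (u j)" by (simp add: h_def)
          have prev: "vec_norm (next_hidden (with_bias N b) (h j) (u j) (m - 1)) = x (Suc j) (m - 1)"
          proof (cases "m = 1")
            case False
            with m have "m - 1 \<in> {1..num_layers (with_bias N b)}" by auto
            from block_mgu_map[OF net this, of "h j" "u j"] False m show ?thesis
              by (simp add: x_def step)
          qed (simp add: x_def)
          have "x (Suc j) m \<le> layer_rate N m * x j m + mat_norm (W_h N m) * x (Suc j) (m - 1)
              + vec_norm (block N m b)"
            using block_mgu_map_le[OF net[of b], of "h j" "u j" m] h[of j] u j m small[OF m] step prev
            by (simp add: x_def)
          also have "\<dots> \<le> \<rho> * x j m + a * x (Suc j) (m - 1) + vec_norm b"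
            using le_lam[OF m] le_a[OF m] vec_norm_block_le[OF b m]
            by (intro add_mono mult_right_mono) (auto simp: x_def)
          finally show ?thesis .
        qed
      qed (use l in \<open>simp_all add: max_input_nonneg\<close>)
      then show ?thesis using l by (simp add: x_def)
    qed
    have "h k \<in> carrier_vec (dim_state N)"
      using h[of k] by (simp add: H_inv_def)
    moreover have "0 \<le> C * \<mu> ^ k * vec_norm x\<^sub>0 + D * (max_input u k + vec_norm b)"
      using mu CD max_input_nonneg[of u k] by simp
    ultimately have "vec_norm (h k) \<le> C * \<mu> ^ k * vec_norm x\<^sub>0 + D * (max_input u k + vec_norm b)"
      using blocks by (rule vec_norm_le_blocks)
    then show ?thesis by (simp add: h_def distrib_left)
  qed
  show ?thesis
    unfolding mgu_ISS_def ISS_def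
  proof (intro conjI ballI)
    show "compact_vecs (dim_state N) (H_inv N)" "compact_vecs (dim_u N) ?U"
      by (simp_all add: H_inv_eq_unit_cube compact_vecs_unit_cube)
    show "forward_invariant (?w b) (H_inv N) ?U" for b by (rule inv)
    show "\<exists>\<psi>\<in>class_KL. \<exists>\<gamma>\<^sub>u\<in>class_K_inf. \<exists>\<gamma>\<^sub>b\<in>class_K_inf.
        \<forall>k. \<forall>x\<^sub>0\<in>H_inv N. \<forall>u. (\<forall>z<k. u z \<in> ?U) \<longrightarrow>
          (\<forall>b\<in>carrier_vec (dim_state N).
            vec_norm (trajectory (?w b) x\<^sub>0 u k)
              \<le> \<psi> (vec_norm x\<^sub>0) k + \<gamma>\<^sub>u (max_input u k) + \<gamma>\<^sub>b (vec_norm b))"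
    proof (intro bexI)
      show "\<forall>k. \<forall>x\<^sub>0\<in>H_inv N. \<forall>u. (\<forall>z<k. u z \<in> ?U) \<longrightarrow>
          (\<forall>b\<in>carrier_vec (dim_state N).
            vec_norm (trajectory (?w b) x\<^sub>0 u k)
              \<le> C * \<mu> ^ k * vec_norm x\<^sub>0 + D * max_input u k + D * vec_norm b)"
        using bound by blast
    qed (rule geometric_class_KL[OF CD(1) mu] linear_class_K_inf[OF CD(2)])+
  qed
qed

end
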